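(* Let $X$ be a complete metric space and $T:X\to X$ a continuous map. Then $T$ is recurrent if and only if $\Sigma(T)$ contains a continuous map with dense range.
   Context: For a continuous map $g:X\to X$, $\mathrm{R}(T,g)$ is the set of $x\in X$ for which there is a strictly increasing sequence of positive integers $(\omega_n)_n$ with $\lim_n T^{\omega_n}x=g(x)$. $\Sigma(T)$ is the set of all continuous maps $g:X\to X$ such that $\mathrm{R}(T,g)$ is dense in $X$. A point $x$ is recurrent for $T$ if there is a strictly increasing sequence of positive integers $(\theta_n)_n$ with $T^{\theta_n}x\to x$; $T$ is recurrent if its set of recurrent points is dense in $X$. *)

theory Defs
  imports "HOL-Analysis.Analysis"
begin

definition rec_set :: "('a::topological_space \<Rightarrow> 'a) \<Rightarrow> ('a \<Rightarrow> 'a) \<Rightarrow> 'a set" where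
  "rec_set T g = {x. \<exists>\<omega>::nat \<Rightarrow> nat. strict_mono \<omega> \<and> (\<forall>n. 0 < \<omega> n) \<and>
     (\<lambda>n. (T ^^ \<omega> n) x) \<longlonglongrightarrow> g x}"

definition Sigma_maps :: "('a::topological_space \<Rightarrow> 'a) \<Rightarrow> ('a \<Rightarrow> 'a) set" where
  "Sigma_maps T = {g. continuous_on UNIV g \<and> closure (rec_set T g) = UNIV}"

definition recurrent_point :: "('a::topological_space \<Rightarrow> 'a) \<Rightarrow> 'a \<Rightarrow> bool" where
  "recurrent_point T x \<longleftrightarrow> (\<exists>\<theta>::nat \<Rightarrow> nat. strict_mono \<theta> \<and> (\<forall>n. 0 < \<theta> n) \<and>
     (\<lambda>n. (T ^^ \<theta> n) x) \<longlonglongrightarrow> x)"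

definition recurrent :: "('a::topological_space \<Rightarrow> 'a) \<Rightarrow> bool" where
  "recurrent T \<longleftrightarrow> closure {x. recurrent_point T x} = UNIV"

end

theory Submission imports Defs begin

text \<open>If \<open>T\<close> is recurrent, then the identity is a map as required: it is continuous and onto,
  and \<open>rec_set T id\<close> is the set of recurrent points.

  Conversely, let \<open>g \<in> Sigma_maps T\<close> have dense range, and let \<open>U\<close> be open and nonempty. The
  preimage of \<open>U\<close> under \<open>g\<close> is open and nonempty, so it contains a point \<open>x\<close> of \<open>rec_set T g\<close>.
  The orbit of \<open>x\<close> accumulates at \<open>g x \<in> U\<close>, hence visits \<open>U\<close> at two different times, and the
  first of these visits is a point of \<open>U\<close> that returns to \<open>U\<close> (\<open>dense_Sigma_map_imp_returning\<close>).

  Such a return property for all open sets makes every set of points \<open>x\<close> with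
  \<open>dist ((T ^^ k) x) x < \<epsilon>\<close> for some \<open>k > 0\<close> dense, and it is open when \<open>T\<close> is continuous. By the
  Baire category theorem the intersection of these sets over \<open>\<epsilon> = 1, 1/2, 1/3, \<dots>\<close> is dense, and
  it consists of recurrent points (\<open>returning_imp_recurrent\<close>).\<close>

lemma dense_meets_open:
  assumes "closure S = UNIV" "open U" "U \<noteq> {}"
  obtains x where "x \<in> U" "x \<in> S"
  using assms open_Int_closure_eq_empty[of U S] by auto

lemma continuous_on_funpow:
  fixes T :: "'a::topological_space \<Rightarrow> 'a"
  assumes "continuous_on UNIV T"
  shows "continuous_on UNIV (T ^^ k)"
proof (induction k)
  case (Suc k)
  then show ?case
    using continuous_on_compose2[OF assms, of UNIV "T ^^ k"] by (simp add: comp_def)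
qed (simp add: id_def)

text \<open>Arbitrarily close returns to \<open>x\<close> at positive times already give arbitrarily late close
  returns.\<close>

lemma recurrent_pointI:
  fixes T :: "'a::metric_space \<Rightarrow> 'a"
  assumes close: "\<And>\<epsilon>. 0 < \<epsilon> \<Longrightarrow> \<exists>k>0. dist ((T ^^ k) x) x < \<epsilon>"
  shows "recurrent_point T x"
proof -
  have late: "\<exists>k>N. dist ((T ^^ k) x) x < \<epsilon>" if "0 < \<epsilon>" for \<epsilon> N
  proof (cases "\<exists>p>0. (T ^^ p) x = x")
    case True
    then obtain p where p: "p > 0" "(T ^^ p) x = x" by blast
    have "(T ^^ (p * m)) x = x" for m
      using p(2) by (induction m) (simp_all add: funpow_add)
    moreover have "N < p * Suc N"
      using p(1) by (cases p) auto
    ultimately show ?thesis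
      using that by (metis dist_self)
  next
    case False
    \<comment> \<open>No return up to time \<open>N\<close> is closer than \<open>\<delta>\<close>.\<close>
    define \<delta> where "\<delta> = Min (insert \<epsilon> ((\<lambda>k. dist ((T ^^ k) x) x) ` {1..N}))"
    have "0 < dist ((T ^^ k) x) x" if "k \<in> {1..N}" for k
      using False that by (metis One_nat_def Suc_le_eq atLeastAtMost_iff zero_less_dist_iff)
    then have "\<delta> > 0"
      unfolding \<delta>_def using \<open>0 < \<epsilon>\<close> by (subst Min_gr_iff) auto
    then obtain k where k: "k > 0" "dist ((T ^^ k) x) x < \<delta>"
      using close by blast
    have "k > N"
    proof (rule ccontr)
      assume "\<not> k > N"
      then have "\<delta> \<le> dist ((T ^^ k) x) x"
        unfolding \<delta>_def using k(1) by (intro Min_le) auto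
      with k(2) show False by simp
    qed
    moreover have "\<delta> \<le> \<epsilon>"
      unfolding \<delta>_def by (intro Min_le) auto
    ultimately show ?thesis
      using k(2) by (intro exI[of _ k]) auto
  qed
  have "\<exists>\<theta>. \<forall>n. (0 < \<theta> n \<and> dist ((T ^^ \<theta> n) x) x < inverse (real (Suc n))) \<and> \<theta> n < \<theta> (Suc n)"
  proof (intro dependent_nat_choice)
    show "\<exists>k. 0 < k \<and> dist ((T ^^ k) x) x < inverse (real (Suc 0))"
      using close[of 1] by auto
    show "\<exists>l. (0 < l \<and> dist ((T ^^ l) x) x < inverse (real (Suc (Suc n)))) \<and> k < l" for k n
      using late[of "inverse (real (Suc (Suc n)))" k] by (metis gr_implies_not0 neq0_conv inverse_positive_iff_positive of_nat_0_less_iff zero_less_Suc)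
  qed
  then obtain \<theta> where \<theta>: "\<And>n. 0 < \<theta> n" "\<And>n. \<theta> n < \<theta> (Suc n)"
    "\<And>n. dist ((T ^^ \<theta> n) x) x < inverse (real (Suc n))"
    by blast
  have "(\<lambda>n. dist ((T ^^ \<theta> n) x) x) \<longlonglongrightarrow> 0"
    by (rule tendsto_sandwich[OF _ _ tendsto_const LIMSEQ_inverse_real_of_nat])
       (use \<theta>(3) in \<open>auto intro!: always_eventually less_imp_le\<close>)
  then have "(\<lambda>n. (T ^^ \<theta> n) x) \<longlonglongrightarrow> x"
    by (simp add: tendsto_dist_iff[symmetric])
  with \<theta>(1,2) show ?thesis
    unfolding recurrent_point_def strict_mono_Suc_iff by blast
qed

lemma dense_Sigma_map_imp_returning:
  assumes g: "g \<in> Sigma_maps T" "closure (range g) = UNIV"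
    and U: "open U" "U \<noteq> {}"
  shows "\<exists>z\<in>U. \<exists>k>0. (T ^^ k) z \<in> U"
proof -
  obtain y where "g y \<in> U"
    using dense_meets_open[OF g(2) U] by blast
  moreover have "open (g -` U)"
    using g(1) U(1) by (simp add: Sigma_maps_def continuous_on_open_vimage)
  ultimately obtain x where x: "g x \<in> U" "x \<in> rec_set T g"
    using g(1) dense_meets_open[of "rec_set T g" "g -` U"] by (auto simp: Sigma_maps_def)
  then obtain \<omega> where \<omega>: "strict_mono \<omega>" "(\<lambda>n. (T ^^ \<omega> n) x) \<longlonglongrightarrow> g x"
    by (auto simp: rec_set_def)
  obtain N where N: "\<And>n. n \<ge> N \<Longrightarrow> (T ^^ \<omega> n) x \<in> U"
    using topological_tendstoD[OF \<omega>(2) U(1) x(1)] by (auto simp: eventually_sequentially)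
  define k where "k = \<omega> (Suc N) - \<omega> N"
  have less: "\<omega> N < \<omega> (Suc N)"
    using \<omega>(1) by (simp add: strict_mono_Suc_iff)
  then have "(T ^^ k) ((T ^^ \<omega> N) x) = (T ^^ \<omega> (Suc N)) x"
    by (simp add: k_def flip: funpow_add comp_apply[of "T ^^ _"])
  moreover have "k > 0"
    using less by (simp add: k_def)
  ultimately show ?thesis
    using N[of N] N[of "Suc N"] by (metis le_refl lessI less_imp_le)
qed

lemma returning_imp_recurrent:
  fixes T :: "'a::complete_space \<Rightarrow> 'a"
  assumes T: "continuous_on UNIV T"
    and ret: "\<And>U. open U \<Longrightarrow> U \<noteq> {} \<Longrightarrow> \<exists>z\<in>U. \<exists>k>0. (T ^^ k) z \<in> U"
  shows "recurrent T"
proof -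
  define G where "G n = (\<Union>k\<in>{0<..}. {x. dist ((T ^^ k) x) x < inverse (real (Suc n))})" for n
  have "open (G n)" for n
    unfolding G_def
    by (intro open_UN ballI open_Collect_less continuous_intros continuous_on_funpow[OF T])
  moreover have "closure (G n) = UNIV" for n
  proof -
    have "x \<in> closure (G n)" for x
      unfolding closure_approachable
    proof (intro allI impI)
      fix e :: real
      assume "e > 0"
      \<comment> \<open>Two points of a ball of radius \<open>r\<close> are less than \<open>2 * r\<close> apart.\<close>
      define r where "r = min e (inverse (real (Suc n)) / 2)"
      have "r > 0"
        using \<open>e > 0\<close> by (simp add: r_def)
      then obtain z k where z: "z \<in> ball x r" "k > 0" "(T ^^ k) z \<in> ball x r"
        using ret[of "ball x r"] by auto
      have "dist ((T ^^ k) z) z < 2 * r"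
        using z dist_triangle[of "(T ^^ k) z" z x] by (simp add: dist_commute)
      also have "2 * r \<le> inverse (real (Suc n))"
        by (simp add: r_def)
      finally have "z \<in> G n"
        using z(2) by (auto simp: G_def)
      moreover have "dist z x < e"
        using z(1) by (simp add: r_def dist_commute)
      ultimately show "\<exists>z\<in>G n. dist z x < e"
        by blast
    qed
    then show ?thesis by blast
  qed
  ultimately have dense: "closure (\<Inter>n. G n) = UNIV"
    using Met_TC.metric_Baire_category[of "range G"] complete_UNIV by auto
  have "(\<Inter>n. G n) \<subseteq> {x. recurrent_point T x}"
  proof (clarify intro!: recurrent_pointI)
    fix x and \<epsilon> :: real
    assume x: "x \<in> (\<Inter>n. G n)" and "0 < \<epsilon>"
    then obtain n where n: "inverse (real (Suc n)) < \<epsilon>"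
      using reals_Archimedean by blast
    have "x \<in> G n"
      using x by blast
    with n show "\<exists>k>0. dist ((T ^^ k) x) x < \<epsilon>"
      unfolding G_def by fastforce
  qed
  with dense show ?thesis
    unfolding recurrent_def using closure_mono by blast
qed

theorem theorem2p8:
  fixes T :: "'a::complete_space \<Rightarrow> 'a"
  assumes "continuous_on UNIV T"
  shows "recurrent T \<longleftrightarrow>
    (\<exists>g \<in> Sigma_maps T. continuous_on UNIV g \<and> closure (range g) = UNIV)"
proof
  assume "recurrent T"
  then have "id \<in> Sigma_maps T"
    by (simp add: Sigma_maps_def rec_set_def recurrent_def recurrent_point_def)
  then show "\<exists>g \<in> Sigma_maps T. continuous_on UNIV g \<and> closure (range g) = UNIV"
    by (intro bexI[of _ id]) auto
next
  assume "\<exists>g \<in> Sigma_maps T. continuous_on UNIV g \<and> closure (range g) = UNIV"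
  then show "recurrent T"
    using returning_imp_recurrent[OF assms] dense_Sigma_map_imp_returning by blast
qed

end
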